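(* Let $\alpha\in\mathbb{R}$ and let $P_\alpha(X)=X^6+2X^5-(\alpha+3)X^4-2(\alpha+3)X^3+(2-\alpha)X^2+4X+1$. For $\beta\in\mathbb{R}$ let $Q_\beta(X)=X^3+(1-\beta)X^2-(2+\beta)X-1$. (i) If $\alpha<0$, then $P_\alpha$ has no real roots. (ii) If $\alpha\ge0$, then $P_\alpha=Q_{\sqrt\alpha}\,Q_{-\sqrt\alpha}$ and all roots of $P_\alpha$ are real. *)

theory Defs
  imports Complex_Main "HOL-Computational_Algebra.Polynomial"
begin

text \<open>Coefficient lists start with the constant term.\<close>

definition P :: "real \<Rightarrow> real poly" where
  "P \<alpha> = [:1, 4, 2 - \<alpha>, - 2 * (\<alpha> + 3), - (\<alpha> + 3), 2, 1:]"

definition Q :: "real \<Rightarrow> real poly" where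
  "Q \<beta> = [:- 1, - (2 + \<beta>), 1 - \<beta>, 1:]"

end

theory Submission
  imports Defs
begin

text \<open>
  Write \<open>R = X\<^sup>3 + X\<^sup>2 - 2X - 1\<close>. Then \<open>Q \<beta> = R - \<beta> X (X + 1)\<close> and
  \<open>P \<alpha> = R\<^sup>2 - \<alpha> (X (X + 1))\<^sup>2\<close>, which settles the case \<open>\<alpha> < 0\<close>, as \<open>R\<close> does not vanish
  at \<open>0\<close> and \<open>-1\<close>. A root \<open>z\<close> of \<open>P \<alpha>\<close> with \<open>\<alpha> \<ge> 0\<close> is a root of some \<open>Q \<beta>\<close> with \<open>\<beta>\<close> real,
  so that \<open>\<beta> = R(z) / (z (z + 1)) = z - 1/z - 1/(z + 1)\<close>. All three summands have imaginary parts
  of the same sign as that of \<open>z\<close>, hence \<open>z\<close> is real.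
\<close>

lemma poly_P: "poly (P \<alpha>) x = (x^3 + x^2 - 2*x - 1)^2 - \<alpha> * (x * (x + 1))^2"
  unfolding P_def by (simp add: algebra_simps power2_eq_square power3_eq_cube)

lemma P_eq_Q_mult_Q: "P (\<beta>^2) = Q \<beta> * Q (- \<beta>)"
  unfolding P_def Q_def by (simp add: algebra_simps power2_eq_square)

lemma poly_complex_Q:
  "poly (map_poly complex_of_real (Q \<beta>)) z = z^3 + z^2 - 2*z - 1 - of_real \<beta> * (z * (z + 1))"
  unfolding Q_def by (simp add: map_poly_pCons algebra_simps power2_eq_square power3_eq_cube)

lemma poly_P_ne_0:
  assumes "\<alpha> < 0"
  shows "poly (P \<alpha>) x \<noteq> 0"
proof
  assume "poly (P \<alpha>) x = 0"
  then have eq: "(x^3 + x^2 - 2*x - 1)^2 + (- \<alpha>) * (x * (x + 1))^2 = 0"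
    by (simp add: poly_P)
  have "(- \<alpha>) * (x * (x + 1))^2 \<ge> 0"
    using assms by (intro mult_nonneg_nonneg) auto
  with eq have "(x^3 + x^2 - 2*x - 1)^2 = 0" and "(- \<alpha>) * (x * (x + 1))^2 = 0"
    using zero_le_power2[of "x^3 + x^2 - 2*x - 1"] by linarith+
  then have R: "x^3 + x^2 - 2*x - 1 = 0" and "x = 0 \<or> x = -1"
    using assms by (auto simp: add_eq_0_iff2)
  then show False by auto
qed

lemma Im_inverse_eq: "Im (inverse w) = - (Im w / (cmod w)\<^sup>2)"
  by (simp add: cmod_power2)

lemma Q_root_real:
  assumes "poly (map_poly complex_of_real (Q \<beta>)) z = 0"
  shows "z \<in> \<real>"
proof -
  have root: "z^3 + z^2 - 2*z - 1 = of_real \<beta> * (z * (z + 1))"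
    using assms by (simp add: poly_complex_Q)
  \<comment> \<open>At \<open>z = 0\<close> and \<open>z = -1\<close> the right side of
    \<open>root\<close> vanishes, while the left side is -1 and 1.\<close>
  have z0: "z \<noteq> 0" and z1: "z + 1 \<noteq> 0"
    using root by (auto simp: add_eq_0_iff2)
  \<comment> \<open>Products such as \<open>inverse z * z\<close> are left uncancelled, so this is a
    ring identity with the inverses as free symbols.\<close>
  have "(z - inverse z - inverse (z + 1)) * (z * (z + 1)) =
      z * (z * (z + 1)) - (inverse z * z) * (z + 1) - (inverse (z + 1) * (z + 1)) * z"
    by algebra
  also have "\<dots> = z^3 + z^2 - 2*z - 1"
    unfolding left_inverse[OF z0] left_inverse[OF z1]
    by (simp add: algebra_simps power2_eq_square power3_eq_cube)
  finally have "(z - inverse z - inverse (z + 1)) * (z * (z + 1)) = z^3 + z^2 - 2*z - 1" .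
  with root z0 z1 have "z - inverse z - inverse (z + 1) = of_real \<beta>"
    by simp
  from arg_cong[OF this, of Im]
  have "Im z - Im (inverse z) - Im (inverse (z + 1)) = 0"
    by (simp only: minus_complex.simps Im_complex_of_real)
  \<comment> \<open>Since \<open>z + 1\<close> has the same imaginary part as \<open>z\<close>,
    \<open>Im z\<close> factors out.\<close>
  then have "Im z * (1 + 1 / (cmod z)\<^sup>2 + 1 / (cmod (z + 1))\<^sup>2) = 0"
    unfolding Im_inverse_eq by (simp add: algebra_simps)
  moreover have "1 + 1 / (cmod z)\<^sup>2 + 1 / (cmod (z + 1))\<^sup>2 > 0"
    by (intro add_pos_nonneg) auto
  ultimately show ?thesis
    by (auto simp: complex_is_Real_iff)
qed

theorem lemmaA2:
  fixes \<alpha> :: real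
  shows "(\<alpha> < 0 \<longrightarrow> (\<nexists>x::real. poly (P \<alpha>) x = 0)) \<and>
         (\<alpha> \<ge> 0 \<longrightarrow>
            P \<alpha> = Q (sqrt \<alpha>) * Q (- sqrt \<alpha>) \<and>
            (\<forall>z::complex. poly (map_poly complex_of_real (P \<alpha>)) z = 0 \<longrightarrow> z \<in> \<real>))"
proof (intro conjI impI allI)
  assume "\<alpha> < 0"
  then show "\<nexists>x::real. poly (P \<alpha>) x = 0"
    using poly_P_ne_0 by blast
next
  assume "\<alpha> \<ge> 0"
  then show "P \<alpha> = Q (sqrt \<alpha>) * Q (- sqrt \<alpha>)"
    using P_eq_Q_mult_Q[of "sqrt \<alpha>"] by simp
next
  fix z :: complex
  assume "\<alpha> \<ge> 0" and root: "poly (map_poly complex_of_real (P \<alpha>)) z = 0"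
  then have "P \<alpha> = Q (sqrt \<alpha>) * Q (- sqrt \<alpha>)"
    using P_eq_Q_mult_Q[of "sqrt \<alpha>"] by simp
  \<comment> \<open>This carries the factorization over to complex polynomials.\<close>
  moreover have "map_poly complex_of_real (p * q) =
      map_poly complex_of_real p * map_poly complex_of_real q" for p q
    by (intro poly_eqI) (simp add: coeff_map_poly coeff_mult)
  ultimately show "z \<in> \<real>"
    using root Q_root_real by auto
qed

end
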